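(* Let $p>2$ be a prime and let $L:X_p\to X_p$ be any function, where $X_p=\{0,1,\dots,p-1\}^3\subseteq\mathbb{Z}^3$. Let $\Lambda$, the maps $\pi^\lambda_x:\{0,\dots,p-1\}\to\{0,\dots,p-1\}$ associated to $L$, a set $W\subset\Lambda$ of representatives, and subsets $C_\lambda\subseteq X_p$ ($\lambda\in W$) be as defined in the context. Then the following are equivalent: (1) The set $\{\frac1p x+L(x)\mid x\in X_p\}$ is a $p$-partial Steinhaus set. (2) For all $\lambda\in W$ and all $x\in C_\lambda$, the map $\pi^\lambda_x$ is a permutation.
   Context: Let $\|\cdot\|$ be the Euclidean norm on $\mathbb{R}^3$. A squared lattice distance is an element of $\{\|v\|^2\mid v\in\mathbb{Z}^3\}$, i.e. a sum of three integer squares. For an integer $m>1$ let $X_m=\{(a,b,c)\in\mathbb{Z}^3\mid 0\le a,b,c<m\}$. A subset $S\subseteq\mathbb{R}^3$ is an $m$-partial Steinhaus set if (i) $|S\cap(\frac1m x+\mathbb{Z}^3)|=1$ for all $x\in X_m$, and (ii) $\|x-z\|^2$ is not a squared lattice distance for all distinct $x,z\in S$. Every $v\in\mathbb{Z}^3$ is written uniquely as $v=y(v)+p\,\epsilon(v)$ with $y(v)\in X_p$ and $\epsilon(v)\in\mathbb{Z}^3$ (coordinatewise remainder and quotient on division by $p$). $GF(p)$ is the field of integers modulo $p$; its elements are identified with $\{0,1,\dots,p-1\}$. $\Lambda\subseteq X_p$ is the set of $\lambda\in X_p$, $\lambda\ne(0,0,0)$, with $p\mid\|\lambda\|^2$.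 For $\lambda\in\Lambda$, $d(\lambda)\in\{0,\dots,p-1\}$ is the unique element with $\|\lambda\|^2\equiv d(\lambda)p\pmod{p^2}$. For $\lambda\in\Lambda$ and $x\in X_p$, the map $\pi^\lambda_x$ from $\{0,\dots,p-1\}$ to itself is $$\pi^\lambda_x(t)=\frac{t\,d(\lambda)}{2}+\lambda\cdot\bigl[L(y(x+\lambda t))-\epsilon(x+\lambda t)\bigr]\pmod p,$$ where $\cdot$ is the standard dot product and division by $2$ is taken modulo $p$. $W\subset\Lambda$ is a chosen subset of cardinality $p+1$ representing each point $(\alpha,\beta,\gamma)$ of the projective plane $\mathbb{P}^2(GF(p))$ with $\alpha^2+\beta^2+\gamma^2=0$ exactly once. For each $\lambda\in\Lambda$, $\ell_\lambda$ is the one-dimensional subspace of $GF(p)^3$ spanned by $\lambda$ mod $p$, and $C_\lambda$ is a chosen complementary subspace to $\ell_\lambda$ in $GF(p)^3$, viewed as a subset of $X_p$ (of cardinality $p^2$) via $GF(p)=\{0,\dots,p-1\}$. *)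

theory Defs
  imports
    "HOL-Analysis.Analysis"
    "HOL-Number_Theory.Residues"
    "HOL-Number_Theory.Modular_Inverse"
    "HOL-Algebra.Module"
    "HOL-Algebra.AbelCoset"
begin

section \<open>Partial Steinhaus sets\<close>

definition real_vec :: "int ^ 3 \<Rightarrow> real ^ 3"
  where "real_vec v = (\<chi> i. of_int (v $ i))"

definition squared_lattice_distances :: "real set"
  where "squared_lattice_distances = {(norm (real_vec v))\<^sup>2 | v. True}"

definition X :: "int \<Rightarrow> (int ^ 3) set"
  where "X m = {v. \<forall>i. 0 \<le> v $ i \<and> v $ i < m}"

definition partial_steinhaus :: "int \<Rightarrow> (real ^ 3) set \<Rightarrow> bool"
  where "partial_steinhaus m S \<longleftrightarrow>
    (\<forall>x \<in> X m. card (S \<inter> {(1 / of_int m) *\<^sub>R real_vec x + real_vec v | v. True}) = 1) \<and>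
    (\<forall>x \<in> S. \<forall>z \<in> S. x \<noteq> z \<longrightarrow> (norm (x - z))\<^sup>2 \<notin> squared_lattice_distances)"


section \<open>Coordinatewise division with remainder\<close>

definition rem_vec :: "int \<Rightarrow> int ^ 3 \<Rightarrow> int ^ 3"
  where "rem_vec p v = (\<chi> i. v $ i mod p)"

definition quot_vec :: "int \<Rightarrow> int ^ 3 \<Rightarrow> int ^ 3"
  where "quot_vec p v = (\<chi> i. v $ i div p)"

lemma rem_vec_in_X: "p > 0 \<Longrightarrow> rem_vec p v \<in> X p"
  by (simp add: rem_vec_def X_def)

lemma rem_quot_vec: "v = rem_vec p v + p *s quot_vec p v"
  by (simp add: vec_eq_iff rem_vec_def quot_vec_def)


section \<open>The vector space of triples over the residue field\<close>

text \<open>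
  The space has underlying set \<^term>\<open>X p\<close>. The components \<^term>\<open>monoid.mult\<close> and
  \<^term>\<open>one\<close> are only there because the record type of modules extends that of rings;
  they play no role for modules.
\<close>

definition GF3 :: "int \<Rightarrow> (int, int ^ 3) module"
  where "GF3 p =
    \<lparr>carrier = X p,
     monoid.mult = undefined,
     one = undefined,
     zero = 0,
     add = (\<lambda>u v. rem_vec p (u + v)),
     smult = (\<lambda>c v. rem_vec p (c *s v))\<rparr>"

lemma module_GF3:
  assumes "p > 1"
  shows "module (residue_ring p) (GF3 p)"
proof -
  interpret residues p "residue_ring p"
    by (rule residues.intro) (use assms in auto)
  have inv: "\<exists>y\<in>X p. rem_vec p (y + x) = 0" if "x \<in> X p" for x
    by (rule bexI[of _ "rem_vec p (- x)"])
       (use assms in \<open>auto simp: vec_eq_iff rem_vec_def X_def mod_simps\<close>)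
  have "abelian_group (GF3 p)"
    by (rule abelian_groupI)
       (use assms inv in \<open>auto simp: GF3_def rem_vec_in_X vec_eq_iff rem_vec_def X_def mod_simps
          algebra_simps\<close>)
  then show ?thesis
    by (rule moduleI[OF cring])
       (use assms in \<open>auto simp: GF3_def residue_ring_def rem_vec_in_X vec_eq_iff rem_vec_def X_def
          mod_simps algebra_simps\<close>)
qed

definition line :: "int \<Rightarrow> int ^ 3 \<Rightarrow> (int ^ 3) set"
  where "line p v = {c \<odot>\<^bsub>GF3 p\<^esub> v | c. c \<in> carrier (residue_ring p)}"

definition complementary :: "int \<Rightarrow> (int ^ 3) set \<Rightarrow> (int ^ 3) set \<Rightarrow> bool"
  where "complementary p U C \<longleftrightarrow>
    submodule C (residue_ring p) (GF3 p) \<and>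
    U \<inter> C = {\<zero>\<^bsub>GF3 p\<^esub>} \<and> U <+>\<^bsub>GF3 p\<^esub> C = carrier (GF3 p)"


section \<open>Isotropic vectors and the projective plane\<close>

definition sqnorm :: "int ^ 3 \<Rightarrow> int"
  where "sqnorm v = scalar_product v v"

lemma of_int_sqnorm: "of_int (sqnorm v) = (norm (real_vec v))\<^sup>2"
  by (simp add: sqnorm_def scalar_product_def real_vec_def norm_eq_sqrt_inner inner_vec_def
      sum_nonneg)

definition \<Lambda> :: "int \<Rightarrow> (int ^ 3) set"
  where "\<Lambda> p = {v \<in> X p. v \<noteq> 0 \<and> p dvd sqnorm v}"

text \<open>
  Points of the projective plane are the one-dimensional subspaces, so a nonzero vector
  represents a point iff it lies in it.
\<close>

definition projective_plane :: "int \<Rightarrow> (int ^ 3) set set"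
  where "projective_plane p = {line p v | v. v \<in> X p \<and> v \<noteq> 0}"

definition isotropic_points :: "int \<Rightarrow> (int ^ 3) set set"
  where "isotropic_points p = {P \<in> projective_plane p. \<forall>v \<in> P. [sqnorm v = 0] (mod p)}"

definition representatives :: "int \<Rightarrow> (int ^ 3) set \<Rightarrow> bool"
  where "representatives p W \<longleftrightarrow>
    W \<subseteq> \<Lambda> p \<and> int (card W) = p + 1 \<and> (\<forall>P \<in> isotropic_points p. \<exists>!w. w \<in> W \<and> w \<in> P)"


section \<open>The maps $\pi^\lambda_x$\<close>

definition dval :: "int \<Rightarrow> int ^ 3 \<Rightarrow> int"
  where "dval p l = (THE k. k \<in> {0..<p} \<and> [sqnorm l = k * p] (mod p\<^sup>2))"

lemma dval_unique:
  assumes "p > 0" "l \<in> \<Lambda> p"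
  shows "\<exists>!k. k \<in> {0..<p} \<and> [sqnorm l = k * p] (mod p\<^sup>2)"
proof -
  from assms obtain c where c: "sqnorm l = c * p"
    by (auto simp: \<Lambda>_def mult.commute elim: dvdE)
  have iff: "[sqnorm l = k * p] (mod p\<^sup>2) \<longleftrightarrow> [c = k] (mod p)" for k
    using assms by (simp add: c cong_iff_dvd_diff power2_eq_square flip: left_diff_distrib)
  show ?thesis
    unfolding iff using assms
    by (intro ex1I[of _ "c mod p"]) (auto simp: cong_def)
qed

text \<open>The factor \<^term>\<open>modular_inverse p 2\<close> is division by 2 modulo the odd prime \<^term>\<open>p\<close>.\<close>

definition pi_map :: "int \<Rightarrow> (int ^ 3 \<Rightarrow> int ^ 3) \<Rightarrow> int ^ 3 \<Rightarrow> int ^ 3 \<Rightarrow> int \<Rightarrow> int"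
  where "pi_map p L l x t =
    (t * dval p l * modular_inverse p 2
     + scalar_product l (L (rem_vec p (x + t *s l)) - quot_vec p (x + t *s l))) mod p"

end

theory Submission
  imports Defs
begin

text \<open>
  The point of the set in the class of \<open>x\<close> is \<open>1/p\<close> times the integer vector
  \<open>x + p L(x)\<close>, and \<open>x\<close> is recovered from that vector by reduction modulo \<open>p\<close>. So each class
  contains exactly one point, and only the condition on distances has content. The squared
  distance of two points is \<open>\<parallel>u\<parallel>\<^sup>2 / p\<^sup>2\<close>, with \<open>u\<close> the difference of the integer vectors. If this
  is an integer, it is a sum of three rational squares, hence, by the descent of Davenport and
  Cassels (\<open>sum_three_squares_descent\<close>), a sum of three integer squares. The set is therefore
  Steinhaus iff \<open>p\<^sup>2\<close> never divides such an \<open>\<parallel>u\<parallel>\<^sup>2\<close> (\<open>partial_steinhaus_iff\<close>).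

  When \<open>p\<^sup>2\<close> does divide \<open>\<parallel>u\<parallel>\<^sup>2\<close>, the difference \<open>x - z\<close> is isotropic modulo \<open>p\<close>, so it is a
  multiple of some \<open>\<lambda> \<in> W\<close>. Both \<open>x\<close> and \<open>z\<close> then lie in one coset of the line of \<open>\<lambda>\<close>, and this
  coset meets the complement of the line: \<open>x\<close> and \<open>z\<close> are the reductions of \<open>y + s\<lambda>\<close> and
  \<open>y + r\<lambda>\<close> with \<open>y\<close> in the complement and \<open>s \<noteq> r\<close> in \<open>{0..<p}\<close>
  (\<open>isotropic_difference_collinear\<close>). Expanding the norm along the line gives
  \<open>\<parallel>u\<parallel>\<^sup>2 \<equiv> 2 p (s - r) (\<pi>(s) - \<pi>(r))\<close> modulo \<open>p\<^sup>2\<close>, where \<open>\<pi>\<close> is the map of \<open>\<lambda>\<close> and \<open>y\<close>,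
  so that \<open>p\<^sup>2\<close> divides \<open>\<parallel>u\<parallel>\<^sup>2\<close> exactly when \<open>\<pi>\<close> takes equal values at \<open>s\<close> and \<open>r\<close>
  (\<open>pi_map_eq_iff\<close>). Hence the forbidden distances are the failures of injectivity of the maps
  \<open>\<pi>\<close>, and a self-map of a finite set is injective iff it is a permutation.
\<close>

section \<open>Rational and integral sums of three squares\<close>

lemma sqnorm_coordinates: "sqnorm v = (v $ 1)\<^sup>2 + (v $ 2)\<^sup>2 + (v $ 3)\<^sup>2"
  by (simp add: sqnorm_def scalar_product_def sum_3 power2_eq_square)

lemma scalar_product_coordinates:
  "scalar_product (u :: int ^ 3) v = u $ 1 * v $ 1 + u $ 2 * v $ 2 + u $ 3 * v $ 3"
  by (simp add: scalar_product_def sum_3)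

lemma sqnorm_nonneg: "0 \<le> sqnorm v"
  by (simp add: sqnorm_coordinates)

lemma sqnorm_eq_0_iff: "sqnorm v = 0 \<longleftrightarrow> v = 0"
  by (simp add: sqnorm_coordinates vec_eq_iff forall_3 add_nonneg_eq_0_iff)

lemma sqnorm_scale: "sqnorm (k *s v) = k\<^sup>2 * sqnorm v"
  by (simp add: sqnorm_coordinates algebra_simps)

lemma exists_near_multiple:
  fixes a q :: int
  assumes "q > 0"
  shows "\<exists>y. 4 * (a - q * y)\<^sup>2 \<le> q\<^sup>2"
proof -
  define y where "y = (2 * a + q) div (2 * q)"
  have "2 * a + q = 2 * q * y + (2 * a + q) mod (2 * q)"
    by (simp add: y_def)
  moreover have "0 \<le> (2 * a + q) mod (2 * q)" "(2 * a + q) mod (2 * q) < 2 * q"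
    using assms by simp_all
  ultimately have "\<bar>2 * (a - q * y)\<bar> \<le> q"
    by (simp add: algebra_simps abs_le_iff)
  then have "(2 * (a - q * y))\<^sup>2 \<le> q\<^sup>2"
    using abs_le_square_iff[of "2 * (a - q * y)" q] assms by simp
  then show ?thesis
    by (intro exI[of _ y]) (simp add: four_x_squared del: right_diff_distrib_numeral)
qed

text \<open>
  This is the theorem of Davenport and Cassels for three squares. The rational point \<open>u/q\<close> lies on
  the sphere of squared radius \<open>n\<close>. The line through it and a nearest lattice point \<open>y\<close> meets the
  sphere in a second rational point, whose denominator is at most \<open>q \<parallel>u/q - y\<parallel>\<^sup>2 \<le> 3q/4\<close> since
  each coordinate of \<open>u/q - y\<close> is at most \<open>1/2\<close> in absolute value. The descent stops when the
  rational point is itself a lattice point.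
\<close>

lemma sum_three_squares_descent:
  fixes u :: "int ^ 3" and n q :: int
  assumes "q > 0" and "sqnorm u = n * q\<^sup>2"
  shows "\<exists>v. sqnorm v = n"
  using assms
proof (induction "nat q" arbitrary: q u rule: less_induct)
  case less
  obtain f where f: "\<And>i. 4 * (u $ i - q * f i)\<^sup>2 \<le> q\<^sup>2"
    using choice[OF allI[OF exists_near_multiple[OF less.prems(1)]], of "\<lambda>i. u $ i"] by blast
  define y :: "int ^ 3" where "y = (\<chi> i. f i)"
  define r where "r = u - q *s y"
  \<comment> \<open>The second intersection point is \<open>(a u + b y) / q'\<close>.\<close>
  define a where "a = sqnorm y - n"
  define b where "b = 2 * (n * q - scalar_product u y)"
  define q' where "q' = a * q + b"
  have r_bound: "4 * sqnorm r \<le> 3 * q\<^sup>2"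
    using f[of 1] f[of 2] f[of 3] by (simp add: r_def y_def sqnorm_coordinates)
  have "sqnorm r = sqnorm u - 2 * q * scalar_product u y + q\<^sup>2 * sqnorm y"
    by (simp add: r_def sqnorm_coordinates scalar_product_coordinates algebra_simps
        power2_eq_square)
  also have "\<dots> = q * q'"
    by (simp add: less.prems q'_def a_def b_def algebra_simps power2_eq_square)
  finally have r_q': "sqnorm r = q * q'" .
  show ?case
  proof (cases "r = 0")
    case True
    then have "u = q *s y" by (simp add: r_def)
    then have "q\<^sup>2 * sqnorm y = n * q\<^sup>2"
      using less.prems(2) by (simp add: sqnorm_scale)
    then show ?thesis
      using less.prems(1) by (intro exI[of _ y]) simp
  next
    case False
    then have "sqnorm r > 0"
      using sqnorm_nonneg[of r] sqnorm_eq_0_iff[of r] by linarith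
    then have "q' > 0"
      using r_q' less.prems(1) by (simp add: zero_less_mult_iff)
    have "q * (4 * q') \<le> q * (3 * q)"
      using r_bound r_q' by (simp add: power2_eq_square)
    then have "4 * q' \<le> 3 * q"
      using less.prems(1) by simp
    then have "q' < q"
      using less.prems(1) by simp
    have "sqnorm (a *s u + b *s y)
        = a\<^sup>2 * sqnorm u + 2 * a * b * scalar_product u y + b\<^sup>2 * sqnorm y"
      by (simp add: sqnorm_coordinates scalar_product_coordinates algebra_simps
          power2_eq_square)
    also have "\<dots> = a\<^sup>2 * (n * q\<^sup>2) + a * b * (2 * n * q - b) + b\<^sup>2 * (a + n)"
    proof -
      have "2 * scalar_product u y = 2 * n * q - b" "sqnorm y = a + n"
        by (simp_all add: a_def b_def)
      moreover have "2 * a * b * scalar_product u y = a * b * (2 * scalar_product u y)"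
        by simp
      ultimately show ?thesis
        using less.prems(2) by (simp only:)
    qed
    also have "\<dots> = n * q'\<^sup>2"
      by (simp add: q'_def algebra_simps power2_eq_square)
    finally show ?thesis
      using less.hyps[of q' "a *s u + b *s y"] \<open>q' > 0\<close> \<open>q' < q\<close> by simp
  qed
qed

corollary quotient_in_squared_lattice_distances_iff:
  fixes u :: "int ^ 3" and q :: int
  assumes "q > 0"
  shows "of_int (sqnorm u) / (of_int q)\<^sup>2 \<in> squared_lattice_distances \<longleftrightarrow> q\<^sup>2 dvd sqnorm u"
proof
  assume "of_int (sqnorm u) / (of_int q)\<^sup>2 \<in> squared_lattice_distances"
  then obtain v where "real_of_int (sqnorm u) / (of_int q)\<^sup>2 = of_int (sqnorm v)"
    by (auto simp: squared_lattice_distances_def of_int_sqnorm)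
  then have "real_of_int (sqnorm u) = of_int (q\<^sup>2 * sqnorm v)"
    using assms by (simp add: field_simps)
  then have "sqnorm u = q\<^sup>2 * sqnorm v"
    by (simp only: of_int_eq_iff)
  then show "q\<^sup>2 dvd sqnorm u" by simp
next
  assume "q\<^sup>2 dvd sqnorm u"
  then obtain n where n: "sqnorm u = n * q\<^sup>2"
    by (metis dvd_def mult.commute)
  then obtain v where "sqnorm v = n"
    using sum_three_squares_descent[OF assms] by blast
  then have "of_int (sqnorm u) / (of_int q)\<^sup>2 = (norm (real_vec v))\<^sup>2"
    using n assms by (simp flip: of_int_sqnorm)
  then show "of_int (sqnorm u) / (of_int q)\<^sup>2 \<in> squared_lattice_distances"
    by (auto simp: squared_lattice_distances_def)
qed


section \<open>The Steinhaus property as a divisibility condition\<close>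

text \<open>
  This is \<open>p\<close> times the point \<open>x/p + L(x)\<close>, an integer vector.
\<close>

definition scaled_point :: "int \<Rightarrow> (int ^ 3 \<Rightarrow> int ^ 3) \<Rightarrow> int ^ 3 \<Rightarrow> int ^ 3"
  where "scaled_point p L x = x + p *s L x"

lemma rem_vec_eq_self: "x \<in> X p \<Longrightarrow> rem_vec p x = x"
  by (simp add: vec_eq_iff rem_vec_def X_def)

lemma rem_vec_add_multiple: "rem_vec p (x + p *s v) = rem_vec p x"
  by (simp add: vec_eq_iff rem_vec_def)

lemma real_vec_scaled_point:
  "p > 0 \<Longrightarrow> (1 / of_int p) *\<^sub>R real_vec x + real_vec v
    = (1 / of_int p) *\<^sub>R real_vec (x + p *s v)"
  by (simp add: vec_eq_iff real_vec_def field_simps)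

lemma real_vec_eq_iff: "real_vec u = real_vec v \<longleftrightarrow> u = v"
  by (simp add: vec_eq_iff real_vec_def)

text \<open>
  Since reduction modulo \<open>p\<close> recovers \<open>x\<close> from its scaled point, the first Steinhaus condition holds
  automatically. In the second, the scaling turns a squared distance into the squared norm of an
  integer vector divided by \<open>p\<^sup>2\<close>.
\<close>

lemma partial_steinhaus_iff:
  fixes p :: int
  assumes "p > 0"
  shows "partial_steinhaus p {(1 / of_int p) *\<^sub>R real_vec x + real_vec (L x) | x. x \<in> X p}
    \<longleftrightarrow> (\<forall>x \<in> X p. \<forall>z \<in> X p. x \<noteq> z \<longrightarrow>
          \<not> p\<^sup>2 dvd sqnorm (scaled_point p L x - scaled_point p L z))"
proof -
  define P where "P v = (1 / real_of_int p) *\<^sub>R real_vec v" for v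
  have P_eq_iff: "P u = P v \<longleftrightarrow> u = v" for u v
    using assms by (simp add: P_def real_vec_eq_iff)
  have eq_iff: "scaled_point p L x = z + p *s v \<longleftrightarrow> x = z \<and> v = L x"
    if "x \<in> X p" "z \<in> X p" for x z v
  proof
    assume eq: "scaled_point p L x = z + p *s v"
    then have "x = z"
      using that by (metis rem_vec_add_multiple rem_vec_eq_self scaled_point_def)
    moreover have "p *s L x = p *s v"
      using eq \<open>x = z\<close> by (simp add: scaled_point_def)
    then have "L x = v"
      using assms by (simp add: vec_eq_iff)
    ultimately show "x = z \<and> v = L x" by simp
  qed (simp add: scaled_point_def)
  have S: "{(1 / of_int p) *\<^sub>R real_vec x + real_vec (L x) | x. x \<in> X p}
      = (\<lambda>x. P (scaled_point p L x)) ` X p"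
    using assms by (auto simp: real_vec_scaled_point P_def scaled_point_def)
  have coset: "{(1 / of_int p) *\<^sub>R real_vec x + real_vec v | v. True}
      = {P (x + p *s v) | v. True}" for x
    using assms by (simp add: real_vec_scaled_point P_def)
  have "(\<lambda>x. P (scaled_point p L x)) ` X p \<inter> {P (z + p *s v) | v. True}
      = {P (scaled_point p L z)}" if "z \<in> X p" for z
    using that by (auto simp: P_eq_iff eq_iff)
  then have "card ((\<lambda>x. P (scaled_point p L x)) ` X p \<inter> {P (z + p *s v) | v. True}) = 1"
    if "z \<in> X p" for z
    using that by simp
  moreover have "(norm (P u - P v))\<^sup>2 \<in> squared_lattice_distances \<longleftrightarrow> p\<^sup>2 dvd sqnorm (u - v)"
    for u v
  proof -
    have "P u - P v = (1 / real_of_int p) *\<^sub>R real_vec (u - v)"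
      by (simp add: P_def vec_eq_iff real_vec_def diff_divide_distrib)
    then have "(norm (P u - P v))\<^sup>2 = of_int (sqnorm (u - v)) / (of_int p)\<^sup>2"
      by (simp add: of_int_sqnorm power_divide)
    then show ?thesis
      using quotient_in_squared_lattice_distances_iff[OF assms] by simp
  qed
  moreover have "scaled_point p L x = scaled_point p L z \<longleftrightarrow> x = z"
    if "x \<in> X p" "z \<in> X p" for x z
    using eq_iff[OF that, of "L z"] by (auto simp: scaled_point_def)
  ultimately show ?thesis
    unfolding partial_steinhaus_def S coset by (auto simp: P_eq_iff)
qed


section \<open>Points on a common isotropic line\<close>

text \<open>
  The norm of \<open>k l + p w\<close> is \<open>k\<^sup>2 \<parallel>l\<parallel>\<^sup>2 + 2 k p (l \<cdot> w)\<close> modulo \<open>p\<^sup>2\<close>. As \<open>\<parallel>l\<parallel>\<^sup>2\<close> is \<open>d p\<close>, the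
  factor \<open>k p\<close> splits off, and \<open>k\<close> is a unit.
\<close>

lemma sq_dvd_sqnorm_iff:
  fixes p k d :: int
  assumes "prime p" and "[sqnorm l = d * p] (mod p\<^sup>2)" and "\<not> p dvd k"
  shows "p\<^sup>2 dvd sqnorm (k *s l + p *s w) \<longleftrightarrow> p dvd k * d + 2 * scalar_product l w"
proof -
  obtain e where e: "sqnorm l = d * p + p\<^sup>2 * e"
    using assms(2) by (metis cong_iff_lin cong_sym)
  have "sqnorm (k *s l + p *s w)
      = k\<^sup>2 * sqnorm l + 2 * k * p * scalar_product l w + p\<^sup>2 * sqnorm w"
    by (simp add: sqnorm_coordinates scalar_product_coordinates algebra_simps power2_eq_square)
  also have "\<dots> = p * (k * (k * d + 2 * scalar_product l w)) + p\<^sup>2 * (k\<^sup>2 * e + sqnorm w)"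
    by (simp add: e algebra_simps power2_eq_square)
  finally have "p\<^sup>2 dvd sqnorm (k *s l + p *s w)
      \<longleftrightarrow> p\<^sup>2 dvd p * (k * (k * d + 2 * scalar_product l w))"
    by (simp add: dvd_add_left_iff)
  also have "\<dots> \<longleftrightarrow> p dvd k * (k * d + 2 * scalar_product l w)"
    using assms(1) by (simp add: power2_eq_square)
  also have "\<dots> \<longleftrightarrow> p dvd k * d + 2 * scalar_product l w"
    using assms(1,3) by (simp add: prime_dvd_mult_iff)
  finally show ?thesis .
qed

text \<open>
  The correction by the quotient vector in \<open>\<pi>\<close> makes the scaled point of the reduction of
  \<open>x + t l\<close> equal to \<open>x + t l + p A(t)\<close>, where \<open>A(t)\<close> is the vector paired with \<open>l\<close> in \<open>\<pi>\<close>. So the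
  difference of two scaled points has the form \<open>k l + p w\<close>, and the criterion for it, halved
  modulo \<open>p\<close>, says that the values of \<open>\<pi>\<close> agree.
\<close>

lemma pi_map_eq_iff:
  fixes p :: int
  assumes "prime p" and "p > 2" and "l \<in> \<Lambda> p"
    and "s \<in> {0..<p}" and "r \<in> {0..<p}" and "s \<noteq> r"
  shows "pi_map p L l x s = pi_map p L l x r \<longleftrightarrow>
    p\<^sup>2 dvd sqnorm (scaled_point p L (rem_vec p (x + s *s l))
                    - scaled_point p L (rem_vec p (x + r *s l)))"
proof -
  define A where "A t = L (rem_vec p (x + t *s l)) - quot_vec p (x + t *s l)" for t
  define w where "w = A s - A r"
  define h where "h = modular_inverse p 2"
  have scaled: "scaled_point p L (rem_vec p (x + t *s l)) = x + t *s l + p *s A t" for t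
    using rem_quot_vec[of "x + t *s l" p]
    by (simp add: scaled_point_def A_def vec_eq_iff algebra_simps)
  have diff: "scaled_point p L (rem_vec p (x + s *s l))
      - scaled_point p L (rem_vec p (x + r *s l)) = (s - r) *s l + p *s w"
    unfolding scaled by (simp add: w_def vec_eq_iff algebra_simps)
  have d: "[sqnorm l = dval p l * p] (mod p\<^sup>2)"
    using theI'[OF dval_unique[of p l]] assms(2,3) by (simp add: dval_def)
  have "\<not> p dvd s - r"
    using assms(4-6) by (simp flip: mod_eq_dvd_iff)
  have "coprime 2 p"
    using assms(1,2) by (simp add: prime_int_iff prime_odd_int coprime_commute)
  then have h: "[h * 2 = 1] (mod p)"
    unfolding h_def by (rule cong_modular_inverse2)
  have "pi_map p L l x s = pi_map p L l x r
      \<longleftrightarrow> p dvd (s - r) * dval p l * h + scalar_product l w"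
    by (simp add: pi_map_def mod_eq_dvd_iff w_def h_def scalar_product_coordinates
        algebra_simps flip: A_def)
  also have "\<dots> \<longleftrightarrow> p dvd 2 * ((s - r) * dval p l * h + scalar_product l w)"
    using \<open>coprime 2 p\<close> by (simp only: coprime_dvd_mult_right_iff coprime_commute)
  also have "\<dots> \<longleftrightarrow> p dvd (s - r) * dval p l + 2 * scalar_product l w"
  proof -
    have "[(s - r) * dval p l * (h * 2) + 2 * scalar_product l w
        = (s - r) * dval p l * 1 + 2 * scalar_product l w] (mod p)"
      by (intro cong_add cong_mult cong_refl h)
    then show ?thesis
      by (intro cong_dvd_iff) (simp add: algebra_simps)
  qed
  also have "\<dots> \<longleftrightarrow> p\<^sup>2 dvd sqnorm ((s - r) *s l + p *s w)"
    using sq_dvd_sqnorm_iff[OF assms(1) d \<open>\<not> p dvd s - r\<close>] by simp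
  finally show ?thesis
    unfolding diff .
qed


section \<open>Vectors with isotropic difference\<close>

lemma rem_vec_eq_iff: "rem_vec p u = rem_vec p v \<longleftrightarrow> (\<forall>i. p dvd u $ i - v $ i)"
  by (simp add: vec_eq_iff rem_vec_def mod_eq_dvd_iff)

lemma line_eq: "p > 1 \<Longrightarrow> line p v = {rem_vec p (c *s v) | c. c \<in> {0..<p}}"
  by (auto simp: line_def GF3_def residue_ring_def)

lemma rem_vec_scale_mod: "rem_vec p (x + (c mod p) *s v) = rem_vec p (x + c *s v)"
  by (simp add: vec_eq_iff rem_vec_def)
     (metis mod_add_right_eq mod_mult_left_eq)

lemma sqnorm_rem_vec_cong: "[sqnorm (rem_vec p v) = sqnorm v] (mod p)"
  unfolding sqnorm_coordinates rem_vec_def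
  by (intro cong_add cong_pow) (simp_all add: cong_def)

text \<open>
  The line of \<open>v\<close> is an isotropic point of the projective plane, so it contains some \<open>w \<in> W\<close>, say
  \<open>w = c v\<close>. Because \<open>w\<close> is not zero, \<open>c\<close> can be inverted.
\<close>

lemma representative_of_isotropic_vector:
  fixes p :: int
  assumes "prime p" and "representatives p W" and "p dvd sqnorm v" and "rem_vec p v \<noteq> 0"
  obtains w k where "w \<in> W" and "rem_vec p v = rem_vec p (k *s w)"
proof -
  have p: "p > 1"
    using assms(1) by (simp add: prime_gt_1_int)
  let ?v = "rem_vec p v"
  have v: "?v \<in> X p"
    using p by (simp add: rem_vec_in_X)
  have "p dvd sqnorm ?v"
    using assms(3) sqnorm_rem_vec_cong[of p v] by (simp add: cong_dvd_iff)
  then have "\<forall>u \<in> line p ?v. [sqnorm u = 0] (mod p)"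
    using p by (auto simp: line_eq cong_0_iff sqnorm_scale cong_dvd_iff[OF sqnorm_rem_vec_cong])
  then have "line p ?v \<in> isotropic_points p"
    using v assms(4) by (auto simp: isotropic_points_def projective_plane_def)
  then obtain w where "w \<in> W" "w \<in> line p ?v"
    using assms(2) unfolding representatives_def by meson
  then obtain c where w: "w \<in> W" "w = rem_vec p (c *s ?v)"
    unfolding line_eq[OF p] by blast
  then have "w \<noteq> 0"
    using assms(2) by (auto simp: representatives_def \<Lambda>_def)
  have "\<not> p dvd c"
  proof
    assume "p dvd c"
    with w \<open>w \<noteq> 0\<close> show False by (simp add: vec_eq_iff rem_vec_def)
  qed
  then have "coprime c p"
    using assms(1) by (metis coprime_commute prime_imp_coprime)
  then obtain k where k: "[c * k = 1] (mod p)"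
    using cong_solve_coprime_int by blast
  have "rem_vec p (k *s w) $ i = ?v $ i" for i
  proof -
    have "[k * (c * v $ i) = 1 * v $ i] (mod p)"
      using cong_scalar_right[OF k, of "v $ i"] by (simp add: algebra_simps)
    then show ?thesis
      by (simp add: w rem_vec_def cong_def mod_simps)
  qed
  then have "?v = rem_vec p (k *s w)"
    by (simp add: vec_eq_iff)
  with w(1) show thesis by (rule that)
qed

lemma complementary_decomposition:
  fixes p :: int
  assumes "p > 1" and "complementary p (line p l) C" and "x \<in> X p"
  obtains y c where "y \<in> C" and "x = rem_vec p (y + c *s l)"
proof -
  have "x \<in> line p l <+>\<^bsub>GF3 p\<^esub> C"
    using assms(2,3) by (simp add: complementary_def GF3_def)
  then obtain c y where "y \<in> C" "x = rem_vec p (rem_vec p (c *s l) + y)"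
    using assms(1) by (auto simp: set_add_def' line_eq) (auto simp: GF3_def)
  then have "x = rem_vec p (y + c *s l)"
    by (simp add: vec_eq_iff rem_vec_def mod_simps add.commute)
  with \<open>y \<in> C\<close> show thesis by (rule that)
qed


text \<open>
  The direction of the line through \<open>x\<close> and \<open>z\<close> comes from the representatives, and its base point
  from decomposing \<open>z\<close> along that direction.
\<close>

lemma isotropic_difference_collinear:
  fixes p :: int
  assumes "prime p" and "representatives p W"
    and compl: "\<And>l. l \<in> W \<Longrightarrow> complementary p (line p l) (C l)"
    and xz: "x \<in> X p" "z \<in> X p" "x \<noteq> z" and "p dvd sqnorm (x - z)"
  obtains l y s r where "l \<in> W" and "y \<in> C l" and "s \<in> {0..<p}" and "r \<in> {0..<p}" and "s \<noteq> r"
    and "x = rem_vec p (y + s *s l)" and "z = rem_vec p (y + r *s l)"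
proof -
  have p: "p > 1"
    using assms(1) by (simp add: prime_gt_1_int)
  have "rem_vec p (x - z) \<noteq> 0"
  proof
    assume "rem_vec p (x - z) = 0"
    then have "rem_vec p x = rem_vec p z"
      by (simp add: vec_eq_iff rem_vec_def mod_eq_dvd_iff mod_0_imp_dvd)
    with xz show False by (simp add: rem_vec_eq_self)
  qed
  then obtain l k where l: "l \<in> W" "rem_vec p (x - z) = rem_vec p (k *s l)"
    using representative_of_isotropic_vector[OF assms(1,2) \<open>p dvd sqnorm (x - z)\<close>] by blast
  obtain y c where y: "y \<in> C l" "z = rem_vec p (y + c *s l)"
    using complementary_decomposition[OF p compl[OF l(1)] xz(2)] .
  define r where "r = c mod p"
  define s where "s = (c + k) mod p"
  have z: "z = rem_vec p (y + r *s l)"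
    by (simp add: y r_def rem_vec_scale_mod)
  have "rem_vec p x = rem_vec p (y + (c + k) *s l)"
  proof -
    have "p dvd x $ i - (y $ i + (c + k) * l $ i)" for i
    proof -
      have "p dvd (x - z) $ i - (k *s l) $ i" "p dvd z $ i - (y + c *s l) $ i"
        using l(2) y(2) xz(2) unfolding rem_vec_eq_iff
        by (auto simp: rem_vec_def mod_eq_dvd_iff dvd_diff_commute)
      from dvd_add[OF this] show ?thesis by (simp add: algebra_simps)
    qed
    then show ?thesis
      unfolding rem_vec_eq_iff vector_add_component vector_smult_component by blast
  qed
  then have x: "x = rem_vec p (y + s *s l)"
    using xz(1) by (simp add: s_def rem_vec_scale_mod rem_vec_eq_self)
  have "r \<in> {0..<p}" "s \<in> {0..<p}"
    using p by (auto simp: r_def s_def)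
  moreover have "s \<noteq> r"
    using xz(3) x z by auto
  ultimately show thesis
    using that l(1) y(1) x z by blast
qed

lemma inj_on_line:
  fixes p :: int
  assumes "prime p" and "l \<in> \<Lambda> p"
  shows "inj_on (\<lambda>t. rem_vec p (y + t *s l)) {0..<p}"
proof (rule inj_onI)
  fix s r
  assume sr: "s \<in> {0..<p}" "r \<in> {0..<p}"
    and "rem_vec p (y + s *s l) = rem_vec p (y + r *s l)"
  then have dvd: "p dvd (s - r) * l $ i" for i
    by (auto simp: rem_vec_eq_iff algebra_simps)
  obtain i where "\<not> p dvd l $ i"
  proof (rule ccontr)
    assume "\<not> thesis"
    then have "p dvd l $ i" for i
      using that by blast
    then have "rem_vec p l = 0"
      by (simp add: vec_eq_iff rem_vec_def)
    then show False
      using assms(2) by (simp add: \<Lambda>_def rem_vec_eq_self)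
  qed
  then have "p dvd s - r"
    using dvd[of i] assms(1) by (simp add: prime_dvd_mult_iff)
  then show "s = r"
    using sr by (simp flip: mod_eq_dvd_iff)
qed


section \<open>The equivalence\<close>

theorem theorem3p10:
  fixes p :: int
    and L :: "int ^ 3 \<Rightarrow> int ^ 3"
    and W :: "(int ^ 3) set"
    and C :: "int ^ 3 \<Rightarrow> (int ^ 3) set"
  assumes "prime p" and "p > 2"
    and "L \<in> X p \<rightarrow> X p"
    and "representatives p W"
    and "\<And>l. l \<in> W \<Longrightarrow> complementary p (line p l) (C l)"
  shows "partial_steinhaus p {(1 / of_int p) *\<^sub>R real_vec x + real_vec (L x) | x. x \<in> X p}
    \<longleftrightarrow> (\<forall>l \<in> W. \<forall>x \<in> C l. bij_betw (pi_map p L l x) {0..<p} {0..<p})"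
proof -
  let ?bad = "\<lambda>x z. p\<^sup>2 dvd sqnorm (scaled_point p L x - scaled_point p L z)"
  have p: "p > 0"
    using assms(2) by simp
  have W: "l \<in> \<Lambda> p" if "l \<in> W" for l
    using that assms(4) by (auto simp: representatives_def)
  have maps: "pi_map p L l x ` {0..<p} \<subseteq> {0..<p}" for l x
    using p by (auto simp: pi_map_def)
  have bij_iff: "bij_betw (pi_map p L l x) {0..<p} {0..<p} \<longleftrightarrow> inj_on (pi_map p L l x) {0..<p}"
    for l x
    using endo_inj_surj[OF finite_atLeastLessThan_int maps] by (auto simp only: bij_betw_def)
  show ?thesis
    unfolding partial_steinhaus_iff[OF p] bij_iff
  proof (intro iffI ballI impI notI)
    fix x z
    assume inj: "\<forall>l \<in> W. \<forall>y \<in> C l. inj_on (pi_map p L l y) {0..<p}"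
      and xz: "x \<in> X p" "z \<in> X p" "x \<noteq> z" and bad: "?bad x z"
    have "p dvd sqnorm (scaled_point p L x - scaled_point p L z)"
      using bad by (metis dvd_trans dvd_triv_left power2_eq_square)
    moreover have "scaled_point p L x - scaled_point p L z = (x - z) + p *s (L x - L z)"
      by (simp add: scaled_point_def vec_eq_iff algebra_simps)
    ultimately have "p dvd sqnorm (x - z)"
      by (metis cong_dvd_iff sqnorm_rem_vec_cong rem_vec_add_multiple)
    then obtain l y s r where l: "l \<in> W" "y \<in> C l"
      and sr: "s \<in> {0..<p}" "r \<in> {0..<p}" "s \<noteq> r"
      and "x = rem_vec p (y + s *s l)" "z = rem_vec p (y + r *s l)"
      using isotropic_difference_collinear[where C = C, OF assms(1,4,5) xz] by blast
    then have "pi_map p L l y s = pi_map p L l y r"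
      using pi_map_eq_iff[OF assms(1,2) W[OF l(1)] sr] bad by simp
    moreover have "inj_on (pi_map p L l y) {0..<p}"
      using inj l by simp
    ultimately have "s = r"
      using sr by (simp only: inj_on_eq_iff)
    with sr(3) show False ..
  next
    fix l y
    assume good: "\<forall>x \<in> X p. \<forall>z \<in> X p. x \<noteq> z \<longrightarrow> \<not> ?bad x z"
      and l: "l \<in> W" "y \<in> C l"
    show "inj_on (pi_map p L l y) {0..<p}"
    proof (rule inj_onI, rule ccontr)
      fix s r
      assume sr: "s \<in> {0..<p}" "r \<in> {0..<p}" and eq: "pi_map p L l y s = pi_map p L l y r"
        and "s \<noteq> r"
      let ?x = "rem_vec p (y + s *s l)" and ?z = "rem_vec p (y + r *s l)"
      have "?bad ?x ?z"
        using pi_map_eq_iff[OF assms(1,2) W[OF l(1)] sr \<open>s \<noteq> r\<close>] eq by simp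
      moreover have "?x \<noteq> ?z"
        using inj_onD[OF inj_on_line[OF assms(1) W[OF l(1)]] _ sr] \<open>s \<noteq> r\<close> by blast
      moreover have "?x \<in> X p" "?z \<in> X p"
        using p by (simp_all add: rem_vec_in_X)
      ultimately show False
        using good by simp
    qed
  qed
qed

end
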